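(* Let $H$ be a real Hilbert space and let $T \in \mathcal{B}(H)$ be a self-adjoint operator. If $T$ is positive semidefinite and $R(T)$ is closed, then $m_r(T) > 0$.
   Context: $\mathcal{B}(H)$ is the set of bounded linear operators on $H$; $T^*$ and $R(T)$ denote the adjoint and the range of $T$. Define $m_r(T) = \inf\{\langle Tx,x\rangle : x \in R(T^* ),\ \|x\|=1\}$ (infimum in the extended reals, with the usual convention $\inf\emptyset=+\infty$, which is relevant only for $T=0$). A self-adjoint operator $T$ is positive semidefinite if $\langle Tx,x\rangle \ge 0$ for all $x\in H$. *)

theory Defs
  imports "HOL-Analysis.Analysis"
begin

text \<open>
  A real Hilbert space is a type of sort \<open>{real_inner, complete_space}\<close>. The adjoint is the
  library constant \<^const>\<open>adjoint\<close>, which is defined by choice and characterised in the library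
  only for Euclidean spaces; \<open>hilbert_adjoint_works\<close> below shows (by Riesz representation) that it
  is the usual Hilbert space adjoint for every bounded operator.
\<close>

definition self_adjoint :: "('a::real_inner \<Rightarrow> 'a) \<Rightarrow> bool" where
  "self_adjoint T \<longleftrightarrow> adjoint T = T"

definition positive_semidefinite :: "('a::real_inner \<Rightarrow> 'a) \<Rightarrow> bool" where
  "positive_semidefinite T \<longleftrightarrow> self_adjoint T \<and> (\<forall>x. 0 \<le> T x \<bullet> x)"

text \<open>In \<^typ>\<open>ereal\<close> the infimum of the empty set is \<open>\<infinity>\<close>.\<close>

definition m_r :: "('a::real_inner \<Rightarrow> 'a) \<Rightarrow> ereal" where
  "m_r T = Inf {ereal (T x \<bullet> x) | x. x \<in> range (adjoint T) \<and> norm x = 1}"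

lemma riesz_representation:
  fixes f :: "'a::{real_inner, complete_space} \<Rightarrow> real"
  assumes "bounded_linear f"
  shows "\<exists>y. \<forall>x. f x = x \<bullet> y"
proof -
  interpret f: bounded_linear f by fact
  define p where "p x = (x \<bullet> x) / 2 - f x" for x
  obtain K where K: "\<And>x. \<bar>f x\<bar> \<le> norm x * K"
    using f.bounded by auto
  have lower: "- K\<^sup>2 / 2 \<le> p x" for x
  proof -
    have "0 \<le> (norm x - K)\<^sup>2" by simp
    then have "norm x * K \<le> (norm x)\<^sup>2 / 2 + K\<^sup>2 / 2"
      by (simp add: power2_diff)
    with K[of x] show ?thesis
      by (simp add: p_def power2_norm_eq_inner abs_le_iff)
  qed
  define I where "I = Inf (range p)"
  have bdd: "bdd_below (range p)"
    using lower by (auto simp: bdd_below_def)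
  have I_le: "I \<le> p x" for x
    unfolding I_def by (rule cInf_lower) (use bdd in auto)
  have para: "(norm (x - y))\<^sup>2 = 4 * (p x + p y - 2 * p ((1/2) *\<^sub>R (x + y)))" for x y
    unfolding p_def f.scaleR f.add power2_norm_eq_inner
    by (simp add: inner_add_left inner_add_right inner_diff_left inner_diff_right
        inner_commute field_simps)
  have "\<exists>x. p x < I + 1 / real (Suc n)" for n
  proof -
    have "Inf (range p) < I + 1 / real (Suc n)" by (simp add: I_def)
    then show ?thesis using cInf_less_iff[OF _ bdd] by auto
  qed
  then obtain s where s: "\<And>n. p (s n) < I + 1 / real (Suc n)"
    by metis
  have dist_s: "(norm (s m - s n))\<^sup>2 \<le> 4 * (1 / real (Suc m) + 1 / real (Suc n))" for m n
    unfolding para using s[of m] s[of n] I_le[of "(1/2) *\<^sub>R (s m + s n)"] by argo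
  have "Cauchy s"
  proof (rule CauchyI)
    fix e :: real assume "0 < e"
    then obtain N where N: "1 / real (Suc N) < e\<^sup>2 / 8"
      using reals_Archimedean[of "e\<^sup>2 / 8"] by (auto simp: inverse_eq_divide)
    have "norm (s m - s n) < e" if "N \<le> m" "N \<le> n" for m n
    proof -
      have "1 / real (Suc m) \<le> 1 / real (Suc N)" "1 / real (Suc n) \<le> 1 / real (Suc N)"
        using that by (simp_all add: frac_le)
      then have "(norm (s m - s n))\<^sup>2 < e\<^sup>2"
        using dist_s[of m n] N by argo
      then show ?thesis using \<open>0 < e\<close> by (simp add: power_less_imp_less_base)
    qed
    then show "\<exists>M. \<forall>m\<ge>M. \<forall>n\<ge>M. norm (s m - s n) < e" by blast
  qed
  then obtain y where y: "s \<longlonglongrightarrow> y"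
    using Cauchy_convergent convergent_def by blast
  have "(\<lambda>n. p (s n)) \<longlonglongrightarrow> p y"
    unfolding p_def by (intro tendsto_intros f.tendsto y) simp
  moreover have "(\<lambda>n. I + 1 / real (Suc n)) \<longlonglongrightarrow> I + 0"
    by (intro tendsto_intros LIMSEQ_Suc lim_1_over_n)
  ultimately have "p y \<le> I"
    using LIMSEQ_le[of "\<lambda>n. p (s n)" "p y" "\<lambda>n. I + 1 / real (Suc n)" I] s less_imp_le by auto
  then have min: "p y \<le> p z" for z
    using I_le[of z] by simp
  have "f x = x \<bullet> y" for x
  proof (rule ccontr)
    assume "f x \<noteq> x \<bullet> y"
    define d where "d = f x - x \<bullet> y"
    have "d \<noteq> 0" using \<open>f x \<noteq> x \<bullet> y\<close> by (simp add: d_def)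
    then have "x \<noteq> 0" by (auto simp: d_def)
    then have xx: "0 < x \<bullet> x" by simp
    have "p (y + t *\<^sub>R x) = p y - t * d + t\<^sup>2 * (x \<bullet> x) / 2" for t
      unfolding p_def d_def f.scaleR f.add
      by (simp add: inner_add_left inner_add_right inner_commute power2_eq_square algebra_simps
          add_divide_distrib)
    then have "t * d \<le> t\<^sup>2 * (x \<bullet> x) / 2" for t
      using min[of "y + t *\<^sub>R x"] by simp
    from this[of "d / (x \<bullet> x)"] have "d\<^sup>2 \<le> 0"
      using xx by (simp add: power2_eq_square field_simps)
    with \<open>d \<noteq> 0\<close> show False by simp
  qed
  then show ?thesis by blast
qed

lemma hilbert_adjoint_works:
  fixes T :: "'a::{real_inner, complete_space} \<Rightarrow> 'b::real_inner"
  assumes "bounded_linear T"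
  shows "T x \<bullet> y = x \<bullet> adjoint T y"
proof -
  have "\<exists>z. \<forall>x. T x \<bullet> y = x \<bullet> z" for y
    by (intro riesz_representation bounded_linear_compose[OF bounded_linear_inner_left] assms)
  then obtain S where S: "\<forall>x y. T x \<bullet> y = x \<bullet> S y" by metis
  then have "adjoint T = S" by (rule adjoint_unique)
  with S show ?thesis by simp
qed

end

theory Submission
  imports Defs
begin

text \<open>
  Expanding \<open>0 \<le> \<langle>T (x \<plusminus> z), x \<plusminus> z\<rangle>\<close> gives \<open>2 \<bar>\<langle>x, T z\<rangle>\<bar> \<le> \<langle>T x, x\<rangle> + \<langle>T z, z\<rangle>\<close>. Hence the set
  \<open>F = {x \<in> R(T). \<langle>T x, x\<rangle> \<le> 1}\<close> is weakly bounded in the Hilbert space \<open>R(T)\<close>, so it is norm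
  bounded by the uniform boundedness principle (a consequence of Baire's theorem). If \<open>F\<close> lies in
  the ball of radius \<open>C\<close>, then scaling a unit vector \<open>x \<in> R(T)\<close> out of that ball shows
  \<open>\<langle>T x, x\<rangle> \<ge> 1 / (C + 1)\<^sup>2\<close>.
\<close>

text \<open>Uniform boundedness for the functionals \<open>y \<bullet> _\<close> on
  \<open>S\<close>: the relatively closed sets \<open>A n\<close>, where all of them are bounded by
  \<open>n\<close>, cover \<open>S\<close>, so by Baire one contains a relative ball, which bounds
  the norms.\<close>

lemma weakly_bounded_imp_bounded:
  fixes S F :: "'a::{real_inner, complete_space} set"
  assumes S: "subspace S" "closed S" and "F \<subseteq> S"
    and weak: "\<And>w. w \<in> S \<Longrightarrow> bounded ((\<lambda>y. y \<bullet> w) ` F)"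
  shows "bounded F"
proof -
  define A where "A n = S \<inter> (\<Inter>y\<in>F. {w. \<bar>y \<bullet> w\<bar> \<le> real n})" for n
  have A_iff: "w \<in> A n \<longleftrightarrow> w \<in> S \<and> (\<forall>y\<in>F. \<bar>y \<bullet> w\<bar> \<le> real n)" for w n
    by (auto simp: A_def)
  have closedin_A: "closedin (top_of_set S) (A n)" for n
    unfolding A_def
    by (intro closedin_closed_Int closed_INT ballI closed_Collect_le continuous_intros)
  have cover: "\<Union>(range A) = S"
  proof -
    have "\<exists>n. w \<in> A n" if w: "w \<in> S" for w
    proof -
      obtain b where b: "\<And>y. y \<in> F \<Longrightarrow> \<bar>y \<bullet> w\<bar> \<le> b"
        using weak[OF w] by (auto simp: bounded_iff)
      obtain n where "b \<le> real n" using real_arch_simple by blast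
      then show ?thesis using b w order_trans unfolding A_iff by blast
    qed
    then show ?thesis by (auto simp: A_iff)
  qed
  have "completely_metrizable_space (top_of_set S)"
    using S by (simp add: completely_metrizable_space_closedin completely_metrizable_space_euclidean)
  \<comment> \<open>Interiors are relative to \<open>S\<close>; since \<open>0 \<in> S\<close>, the
    space is nonempty and Baire gives information.\<close>
  moreover have "top_of_set S interior_of \<Union>(range A) \<noteq> {}"
    using cover subspace_0[OF S(1)] interior_of_topspace[of "top_of_set S"] by auto
  ultimately obtain n where "top_of_set S interior_of A n \<noteq> {}"
    using Baire_category_alt[of "top_of_set S" "range A"] closedin_A by auto
  then obtain w U where "openin (top_of_set S) U" "w \<in> U" and U: "U \<subseteq> A n"
    by (auto simp: interior_of_def)
  then obtain r where r: "r > 0" "ball w r \<inter> S \<subseteq> A n" and "w \<in> A n"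
    unfolding openin_contains_ball by blast
  have "norm y \<le> 4 * real n / r" if "y \<in> F" for y
  proof (cases "y = 0")
    case False
    \<comment> \<open>\<open>v\<close> has norm \<open>r / 2\<close> and the direction of
      \<open>y\<close>, so \<open>y \<bullet> v\<close> recovers \<open>norm y\<close>, while
      \<open>y \<bullet> v = y \<bullet> (w + v) - y \<bullet> w\<close> is at most
      \<open>2 * n\<close>.\<close>
    define v where "v = (r / (2 * norm y)) *\<^sub>R y"
    have "y \<in> S" using that \<open>F \<subseteq> S\<close> by blast
    then have "w + v \<in> S"
      using \<open>w \<in> A n\<close> S(1) by (simp add: A_iff v_def subspace_add subspace_scale)
    moreover have "norm v < r"
      using r(1) False by (simp add: v_def)
    ultimately have "w + v \<in> A n"
      using r(2) by (auto simp: dist_norm)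
    then have "\<bar>y \<bullet> (w + v)\<bar> \<le> real n" "\<bar>y \<bullet> w\<bar> \<le> real n"
      using \<open>w \<in> A n\<close> that by (auto simp: A_iff)
    then have "y \<bullet> v \<le> 2 * real n"
      by (simp add: inner_add_right)
    moreover have "y \<bullet> v = r * norm y / 2"
      using False by (simp add: v_def power2_norm_eq_inner[symmetric] power2_eq_square)
    ultimately show ?thesis
      using r(1) by (simp add: field_simps)
  qed (use r in simp)
  then show ?thesis
    by (auto simp: bounded_iff)
qed

theorem theorem3p2:
  fixes T :: "'a::{real_inner, complete_space} \<Rightarrow> 'a"
  assumes "bounded_linear T"
    and "self_adjoint T"
    and "positive_semidefinite T"
    and "closed (range T)"
  shows "0 < m_r T"
proof -
  interpret T: bounded_linear T by fact
  have adj: "adjoint T = T" using assms(2) by (simp add: self_adjoint_def)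
  have sym: "T x \<bullet> y = x \<bullet> T y" for x y
    using hilbert_adjoint_works[OF assms(1), of x y] by (simp add: adj)
  have pos: "0 \<le> T x \<bullet> x" for x
    using assms(3) by (simp add: positive_semidefinite_def)
  define F where "F = {x \<in> range T. T x \<bullet> x \<le> 1}"
  have weak: "\<bar>x \<bullet> T z\<bar> \<le> (1 + T z \<bullet> z) / 2" if "x \<in> F" for x z
  proof -
    have "T z \<bullet> x = x \<bullet> T z" "T x \<bullet> z = x \<bullet> T z"
      using sym[of x z] by (simp_all add: inner_commute)
    moreover have "T x \<bullet> x \<le> 1"
      using that by (simp add: F_def)
    ultimately show ?thesis
      using pos[of "x + z"] pos[of "x - z"]
      unfolding T.add T.diff inner_simps by argo
  qed
  have "bounded F"
  proof (rule weakly_bounded_imp_bounded[where S = "range T"])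
    show "subspace (range T)"
      by (simp add: T.linear linear_subspace_image)
    show "bounded ((\<lambda>y. y \<bullet> w) ` F)" if w: "w \<in> range T" for w
    proof -
      \<comment> \<open>Any preimage \<open>z\<close> of \<open>w\<close> yields a bound that does
        not depend on the element of \<open>F\<close>.\<close>
      obtain z where "w = T z" using w by blast
      then show ?thesis
        unfolding bounded_iff using weak[of _ z] by (intro exI[of _ "(1 + T z \<bullet> z) / 2"]) auto
    qed
  qed (use assms(4) in \<open>auto simp: F_def\<close>)
  then obtain C where C: "C > 0" "\<And>x. x \<in> F \<Longrightarrow> norm x \<le> C"
    by (auto simp: bounded_pos)
  have "1 / (C + 1)\<^sup>2 \<le> T x \<bullet> x" if x: "x \<in> range T" "norm x = 1" for x
  proof (rule ccontr)
    assume "\<not> ?thesis"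
    \<comment> \<open>The multiple \<open>(C + 1) *\<^sub>R x\<close> would still lie in
      \<open>F\<close>, yet its norm \<open>C + 1\<close> exceeds \<open>C\<close>.\<close>
    then have "(C + 1)\<^sup>2 * (T x \<bullet> x) \<le> 1"
      using C(1) by (simp add: field_simps)
    moreover have "(C + 1) *\<^sub>R x \<in> range T"
      using x(1) by (auto simp: T.scaleR[symmetric])
    ultimately have "(C + 1) *\<^sub>R x \<in> F"
      by (simp add: F_def T.scaleR power2_eq_square mult.assoc)
    then show False
      using C x(2) by fastforce
  qed
  \<comment> \<open>This includes \<open>T = 0\<close>, where the infimum is over the empty
    set.\<close>
  then have "ereal (1 / (C + 1)\<^sup>2) \<le> m_r T"
    unfolding m_r_def adj by (intro Inf_greatest) auto
  moreover have "0 < ereal (1 / (C + 1)\<^sup>2)"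
    using C(1) by simp
  ultimately show ?thesis
    by (rule less_le_trans[rotated])
qed

end
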